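(* Let $X$ be a Banach space and let $(e_i)$ be a semi-normalized Schauder basis for $X$ which is bidemocratic. Suppose that there exists $K>0$ such that for all $\alpha,\beta\in\operatorname{span}((e_i))$, $$\frac1K\|\alpha\|\,\|\beta\|\le\|\alpha\otimes\beta\|\le K\|\alpha\|\,\|\beta\|.$$ Then $(e_i)$ is equivalent to the unit vector basis of $c_0$ or of $\ell_p$ for some $1\le p<\infty$.
   Context: A sequence $(e_i)$ is semi-normalized if $0<\inf_i\|e_i\|\le\sup_i\|e_i\|<\infty$. $\operatorname{span}((e_i))$ denotes the set of finite linear combinations of the $e_i$. The multiplication $\otimes$ on $\operatorname{span}((e_i))$: for $\alpha=\sum_{i=1}^n a_ie_i$ and $\beta=\sum_{j=1}^m b_je_j$ with $b_m\ne0$, $$\alpha\otimes\beta=\sum_{i=1}^n a_i\Big(\sum_{j=1}^m b_j e_{(i-1)m+j}\Big),$$ and $\alpha\otimes 0=0$. The fundamental function of a semi-normalized basic sequence $(f_i)$ is $n\mapsto\sup\{\|\sum_{i\in A}f_i\|: A\subset\mathbb N,\ |A|\le n\}$. Let $(e_i^* )\subset X^*$ be the biorthogonal functionals of $(e_i)$, let $\Phi$ be the fundamental function of $(e_i)$, and let $\Phi^*$ be the fundamental function of $(e_i^* )$ (with respect to the dual norm $\|\cdot\|_*$). The basis $(e_i)$ is bidemocratic if $\Phi^*(n)\asymp n/\Phi(n)$, where $a_n\asymp b_n$ means that there is $C>0$ with $a_n/C\le b_n\le Ca_n$ for all $n\in\mathbb N$. Two basic sequences $(x_i)$, $(y_i)$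 are equivalent if there is $C>0$ with $\frac1C\|\sum a_ix_i\|\le\|\sum a_iy_i\|\le C\|\sum a_ix_i\|$ for all finitely supported scalar sequences $(a_i)$. *)

theory Defs
  imports "HOL-Analysis.Analysis"
begin

text \<open>
  Sequences are indexed from 0: the vector written \<open>e\<^sub>i\<close> with \<open>i \<ge> 1\<close> is \<open>e (i - 1)\<close>.
\<close>

definition semi_normalized :: "(nat \<Rightarrow> 'a::real_normed_vector) \<Rightarrow> bool" where
  "semi_normalized e \<longleftrightarrow> 0 < (INF i. norm (e i)) \<and> bdd_above (range (\<lambda>i. norm (e i)))"

definition schauder_basis :: "(nat \<Rightarrow> 'a::real_normed_vector) \<Rightarrow> bool" where
  "schauder_basis e \<longleftrightarrow> (\<forall>x. \<exists>!a :: nat \<Rightarrow> real. (\<lambda>i. a i *\<^sub>R e i) sums x)"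

text \<open>
  For a Schauder basis there is exactly one such functional: existence is the continuity of the
  coordinate functionals, uniqueness is the density of the span.
\<close>

definition biorthogonal :: "(nat \<Rightarrow> 'a::real_normed_vector) \<Rightarrow> nat \<Rightarrow> ('a \<Rightarrow>\<^sub>L real)" where
  "biorthogonal e i = (THE f. \<forall>j. blinfun_apply f (e j) = (if i = j then 1 else 0))"

definition fundamental_function :: "(nat \<Rightarrow> 'a::real_normed_vector) \<Rightarrow> nat \<Rightarrow> real" where
  "fundamental_function f n = Sup {norm (\<Sum>i\<in>A. f i) |A. finite A \<and> card A \<le> n}"

definition asymp_equiv_const :: "(nat \<Rightarrow> real) \<Rightarrow> (nat \<Rightarrow> real) \<Rightarrow> bool" where
  "asymp_equiv_const a b \<longleftrightarrow> (\<exists>C>0. \<forall>n\<ge>1. a n / C \<le> b n \<and> b n \<le> C * a n)"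

definition bidemocratic :: "(nat \<Rightarrow> 'a::real_normed_vector) \<Rightarrow> bool" where
  "bidemocratic e \<longleftrightarrow>
     asymp_equiv_const (fundamental_function (biorthogonal e))
       (\<lambda>n. real n / fundamental_function e n)"

text \<open>
  Coefficient of \<open>e i\<close> in the finite expansion of a vector of the linear span; meaningful when
  \<open>e\<close> is injective with linearly independent range, as every Schauder basis is.
\<close>

definition coeff_at :: "(nat \<Rightarrow> 'a::real_vector) \<Rightarrow> 'a \<Rightarrow> nat \<Rightarrow> real" where
  "coeff_at e x i = representation (range e) x (e i)"

text \<open>
  For nonzero \<open>x\<close> in the span, \<open>support_length e x\<close> is one more than the largest 0-based index of a
  nonzero coefficient, and \<open>support_length e 0 = 0\<close>.
\<close>

definition support_length :: "(nat \<Rightarrow> 'a::real_vector) \<Rightarrow> 'a \<Rightarrow> nat" where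
  "support_length e x = (LEAST n. \<forall>i\<ge>n. coeff_at e x i = 0)"

text \<open>
  With 0-based \<open>i\<close> and \<open>j\<close>, the index \<open>(i - 1) m + j\<close> becomes \<open>i * m + j\<close>.
  The value at \<open>\<beta> = 0\<close> is an empty sum, hence 0.
\<close>

definition seq_mult :: "(nat \<Rightarrow> 'a::real_vector) \<Rightarrow> 'a \<Rightarrow> 'a \<Rightarrow> 'a" where
  "seq_mult e \<alpha> \<beta> =
     (let n = support_length e \<alpha>; m = support_length e \<beta> in
      \<Sum>i<n. coeff_at e \<alpha> i *\<^sub>R (\<Sum>j<m. coeff_at e \<beta> j *\<^sub>R e (i * m + j)))"

definition unit_vec :: "nat \<Rightarrow> nat \<Rightarrow> real" where
  "unit_vec i = (\<lambda>k. if k = i then 1 else 0)"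

definition lp_norm :: "real \<Rightarrow> (nat \<Rightarrow> real) \<Rightarrow> real" where
  "lp_norm p x = (\<Sum>k. \<bar>x k\<bar> powr p) powr (1 / p)"

definition c0_norm :: "(nat \<Rightarrow> real) \<Rightarrow> real" where
  "c0_norm x = (SUP k. \<bar>x k\<bar>)"

text \<open>
  Equivalence of a sequence \<open>x\<close> in a normed space with a sequence \<open>y\<close> in a space of real
  sequences normed by \<open>N\<close>.
\<close>

definition equivalent_to ::
  "(nat \<Rightarrow> 'a::real_normed_vector) \<Rightarrow> ((nat \<Rightarrow> real) \<Rightarrow> real) \<Rightarrow> (nat \<Rightarrow> nat \<Rightarrow> real) \<Rightarrow> bool" where
  "equivalent_to x N y \<longleftrightarrow>
     (\<exists>C>0. \<forall>a :: nat \<Rightarrow> real. finite {i. a i \<noteq> 0} \<longrightarrow>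
        1 / C * norm (\<Sum>i | a i \<noteq> 0. a i *\<^sub>R x i) \<le> N (\<lambda>k. \<Sum>i | a i \<noteq> 0. a i * y i k) \<and>
        N (\<lambda>k. \<Sum>i | a i \<noteq> 0. a i * y i k) \<le> C * norm (\<Sum>i | a i \<noteq> 0. a i *\<^sub>R x i))"

end

theory Submission imports Defs begin

text \<open>
  Bidemocracy makes the norm of a vector dominate \<open>|v| \<Phi>(|A|)\<close> for every level set \<open>A\<close> of its
  coordinates with value \<open>v\<close>, while the triangle inequality bounds it by the sum of these numbers.
  Since \<open>\<Phi>\<close> is multiplicative up to a constant, it is comparable to \<open>n\<^sup>s\<close> with \<open>0 \<le> s \<le> 1\<close>, so
  for \<open>p = 1 / s\<close> the norm and the \<open>\<ell>\<^sub>p\<close> norm differ at most by a constant times the number of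
  distinct coordinates. For the \<open>N\<close>-th tensor power of a vector with \<open>n\<close> coordinates that number is
  at most \<open>(N + 1)\<^sup>n\<close>. Taking \<open>N\<close>-th roots removes this factor, and only the constant \<open>K\<close> of the
  hypothesis remains.
\<close>

section \<open>Coordinates with respect to a Schauder basis\<close>

lemma sum_div_mod:
  "(\<Sum>k<n*m. F (k div m) (k mod m)) = (\<Sum>i<n. \<Sum>j<m. F i j)" for n m :: nat
proof (cases "m = 0")
  case False
  have "(\<Sum>(i,j)\<in>{..<n}\<times>{..<m}. F i j) = (\<Sum>k<n*m. F (k div m) (k mod m))"
  proof (rule sum.reindex_bij_witness[where i="\<lambda>k. (k div m, k mod m)" and j="\<lambda>(i,j). i * m + j"])
    fix p assume "p \<in> {..<n} \<times> {..<m}"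
    then obtain i j where p: "p = (i, j)" "i < n" "j < m" by auto
    have "i * m + j < (i + 1) * m" using p by simp
    also have "\<dots> \<le> n * m" using p by (intro mult_right_mono) auto
    finally show "(case p of (i, j) \<Rightarrow> i * m + j) \<in> {..<n*m}" using p by simp
  qed (use False in \<open>auto simp: less_mult_imp_div_less\<close>)
  then show ?thesis by (simp add: sum.cartesian_product)
qed simp

locale schauder =
  fixes e :: "nat \<Rightarrow> 'a::banach"
  assumes basis: "schauder_basis e"
begin

definition coord :: "'a \<Rightarrow> nat \<Rightarrow> real" where
  "coord x = (THE a. (\<lambda>i. a i *\<^sub>R e i) sums x)"

definition partial_sum :: "nat \<Rightarrow> 'a \<Rightarrow> 'a" where
  "partial_sum n x = (\<Sum>i<n. coord x i *\<^sub>R e i)"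

lemma coord_sums: "(\<lambda>i. coord x i *\<^sub>R e i) sums x"
  using basis theI'[of "\<lambda>a. (\<lambda>i. a i *\<^sub>R e i) sums x"]
  unfolding schauder_basis_def coord_def by blast

lemma coord_unique: "(\<lambda>i. a i *\<^sub>R e i) sums x \<Longrightarrow> coord x = a"
  using basis coord_sums unfolding schauder_basis_def by blast

lemma coord_add: "coord (x + y) i = coord x i + coord y i"
  using coord_unique[of "\<lambda>i. coord x i + coord y i" "x + y"] sums_add[OF coord_sums coord_sums]
  by (simp add: scaleR_add_left)

lemma coord_scaleR: "coord (c *\<^sub>R x) i = c * coord x i"
  using coord_unique[of "\<lambda>i. c * coord x i" "c *\<^sub>R x"] sums_scaleR_right[OF coord_sums]
  by fastforce

lemma coord_basis: "coord (e j) i = (if i = j then 1 else 0)"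
proof -
  have "(\<lambda>i. (if i = j then e i else 0)) sums e j"
    by (rule sums_single)
  moreover have "(\<lambda>i. (if i = j then e i else 0)) = (\<lambda>i. (if i = j then 1 else 0) *\<^sub>R e i)"
    by auto
  ultimately show ?thesis
    using coord_unique[of "\<lambda>i. if i = j then 1 else 0" "e j"] by simp
qed

lemma linear_partial_sum: "linear (partial_sum n)"
  by (rule linearI)
    (simp_all add: partial_sum_def coord_add coord_scaleR scaleR_add_left sum.distrib
      scaleR_sum_right)

lemma partial_sum_tendsto: "(\<lambda>n. partial_sum n x) \<longlonglongrightarrow> x"
  using coord_sums[of x] unfolding sums_def partial_sum_def .

section \<open>Uniform boundedness of the partial sum operators\<close>

text \<open>Convergent sequences are bounded. The bound is rounded up to a natural number so that
  countably many sets cover the space in the Baire argument.\<close>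

lemma partial_sum_bounded_pointwise: "\<exists>k::nat. \<forall>n. norm (partial_sum n x) \<le> real k"
proof -
  have "Bseq (\<lambda>n. partial_sum n x)"
    using partial_sum_tendsto convergent_def convergent_imp_Bseq by blast
  then obtain K where "\<And>n. norm (partial_sum n x) \<le> K"
    unfolding Bseq_def by blast
  moreover obtain k :: nat where "K \<le> real k"
    using real_arch_simple by blast
  ultimately show ?thesis by (meson order_trans)
qed

lemma approx_by_bounded_partial_sums:
  obtains r k where "r > 0" "k \<ge> 0"
    "\<And>y \<epsilon>. norm y < r \<Longrightarrow> 0 < \<epsilon> \<Longrightarrow> \<exists>w. (\<forall>n. norm (partial_sum n w) \<le> k) \<and> norm (y - w) < \<epsilon>"
proof -
  define W where "W k = {x. \<forall>n. norm (partial_sum n x) \<le> real k}" for k :: nat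
  have "\<exists>k. interior (closure (W k)) \<noteq> {}"
  proof (rule ccontr)
    assume "\<not> ?thesis"
    then have "euclidean interior_of (\<Union>(range (\<lambda>k. closure (W k)))) = {}"
      by (intro Baire_category_alt disjI1 completely_metrizable_space_euclidean) auto
    moreover have "x \<in> (\<Union>(range (\<lambda>k. closure (W k))))" for x
    proof -
      obtain k where "x \<in> W k"
        using partial_sum_bounded_pointwise[of x] unfolding W_def by blast
      then show ?thesis
        using closure_subset[of "W k"] by blast
    qed
    then have "(\<Union>(range (\<lambda>k. closure (W k)))) = UNIV" by blast
    ultimately show False by simp
  qed
  then obtain k x0 where "x0 \<in> interior (closure (W k))" by blast
  then obtain r where r: "r > 0" "ball x0 r \<subseteq> closure (W k)"
    by (meson mem_interior)
  show ?thesis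
  proof (rule that[of r "2 * real k"])
    fix y :: 'a and \<epsilon> :: real
    assume y: "norm y < r" and \<epsilon>: "0 < \<epsilon>"
    have "x0 + y \<in> closure (W k)" "x0 \<in> closure (W k)"
      using r y by (auto simp: dist_norm)
    then obtain u v where uv: "u \<in> W k" "v \<in> W k" "dist u (x0 + y) < \<epsilon> / 2" "dist v x0 < \<epsilon> / 2"
      using \<epsilon> unfolding closure_approachable by (meson half_gt_zero)
    have "norm (partial_sum n (u - v)) \<le> 2 * real k" for n
      using uv(1,2) norm_triangle_ineq4[of "partial_sum n u" "partial_sum n v"]
      unfolding W_def linear_diff[OF linear_partial_sum] by (smt (verit) mem_Collect_eq)
    moreover have "norm (y - (u - v)) < \<epsilon>"
    proof -
      have eq: "(v - x0) - (u - (x0 + y)) = y - (u - v)" by simp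
      show ?thesis
        using uv(3,4) norm_triangle_ineq4[of "v - x0" "u - (x0 + y)"] unfolding eq dist_norm by linarith
    qed
    ultimately show "\<exists>w. (\<forall>n. norm (partial_sum n w) \<le> 2 * real k) \<and> norm (y - w) < \<epsilon>"
      by blast
  qed (use r in auto)
qed

lemma coord_bound:
  assumes "\<And>n. norm (partial_sum n x) \<le> k"
  shows "norm (coord x i *\<^sub>R e i) \<le> 2 * k"
proof -
  have "coord x i *\<^sub>R e i = partial_sum (Suc i) x - partial_sum i x"
    by (simp add: partial_sum_def)
  then show ?thesis
    using norm_triangle_ineq4[of "partial_sum (Suc i) x" "partial_sum i x"] assms[of i] assms[of "Suc i"]
    by simp
qed

lemma e_nonzero: "e i \<noteq> 0"
proof
  assume "e i = 0"
  then have "coord (e i) i = 0"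
    using coord_scaleR[of 0 0 i] by simp
  then show False by (simp add: coord_basis)
qed

text \<open>The coordinates of \<open>x\<close> are the sums of those of the \<open>x\<^sub>j\<close>; dominated convergence
  lets the limit over partial sums pass inside the series.\<close>

lemma partial_sum_series_bound:
  assumes k: "\<And>j n. norm (partial_sum n (X j)) \<le> k j" and "summable k" and X: "X sums x"
  shows "norm (partial_sum n x) \<le> suminf k"
proof -
  have cb: "norm (coord (X j) i) \<le> 2 * k j / norm (e i)" for i j
    using coord_bound[OF k, of j i] e_nonzero[of i] by (simp add: field_simps)
  have sc: "summable (\<lambda>j. coord (X j) i)" for i
    by (rule summable_comparison_test'[where N=0, OF _ cb])
      (intro summable_divide summable_mult \<open>summable k\<close>)
  define y where "y n = (\<Sum>j. partial_sum n (X j))" for n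
  have sp: "summable (\<lambda>j. norm (partial_sum n (X j)))" for n
    by (rule summable_comparison_test'[where N=0, OF \<open>summable k\<close>]) (simp add: k)
  have y_eq: "y n = (\<Sum>i<n. (\<Sum>j. coord (X j) i) *\<^sub>R e i)" for n
    unfolding y_def partial_sum_def
    by (subst suminf_sum) (auto simp: sc suminf_scaleR_left summable_scaleR_left)
  \<comment> \<open>\<open>X j\<close> is the limit of its own partial sums and inherits their
    bound, so \<open>k j + k j\<close> dominates the tails
    \<open>X j - partial_sum n (X j)\<close>.\<close>
  have normX: "norm (X j) \<le> k j" for j
    by (rule LIMSEQ_le_const2[OF tendsto_norm[OF partial_sum_tendsto]]) (use k in auto)
  have "(\<lambda>n. \<Sum>j. norm (X j - partial_sum n (X j))) \<longlonglongrightarrow> (\<Sum>j. 0)"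
  proof (rule conjunct2[OF conjunct2[OF tannerys_theorem]])
    show "(\<lambda>n. norm (X j - partial_sum n (X j))) \<longlonglongrightarrow> 0" for j
      using tendsto_diff[OF tendsto_const partial_sum_tendsto, THEN tendsto_norm, of "X j" "X j"] by simp
    show "\<forall>\<^sub>F (j, n) in sequentially \<times>\<^sub>F sequentially.
        norm (norm (X j - partial_sum n (X j))) \<le> k j + k j"
    proof (rule always_eventually, clarify)
      fix j n
      show "norm (norm (X j - partial_sum n (X j))) \<le> k j + k j"
        using norm_triangle_ineq4[of "X j" "partial_sum n (X j)"] normX[of j] k[of n j] by simp
    qed
    show "summable (\<lambda>j. k j + k j)"
      by (intro summable_add \<open>summable k\<close>)
  qed simp
  moreover have "norm (x - y n) \<le> (\<Sum>j. norm (X j - partial_sum n (X j)))" for n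
  proof -
    have "(\<lambda>j. X j - partial_sum n (X j)) sums (x - y n)"
      unfolding y_def by (intro sums_diff X summable_sums summable_norm_cancel[OF sp])
    moreover have "summable (\<lambda>j. norm (X j - partial_sum n (X j)))"
    proof (rule summable_comparison_test'[where N=0 and g="\<lambda>j. k j + k j"])
      show "norm (norm (X j - partial_sum n (X j))) \<le> k j + k j" for j
        using norm_triangle_ineq4[of "X j" "partial_sum n (X j)"] normX[of j] k[of n j] by simp
    qed (intro summable_add \<open>summable k\<close>)
    ultimately show ?thesis
      using summable_norm sums_unique by metis
  qed
  ultimately have "(\<lambda>n. x - y n) \<longlonglongrightarrow> 0"
    by (intro Lim_null_comparison[of "\<lambda>n. x - y n" "\<lambda>n. \<Sum>j. norm (X j - partial_sum n (X j))"])
      simp_all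
  from tendsto_diff[OF tendsto_const[of x] this] have "y \<longlonglongrightarrow> x"
    by simp
  then have "(\<lambda>i. (\<Sum>j. coord (X j) i) *\<^sub>R e i) sums x"
    unfolding sums_def y_eq .
  \<comment> \<open>\<open>y n\<close> is the partial sum of a series in the \<open>e i\<close> that
    converges to \<open>x\<close>; uniqueness of the expansion identifies its coefficients with
    those of \<open>x\<close>.\<close>
  then have "partial_sum n x = y n"
    unfolding y_eq partial_sum_def using coord_unique by metis
  also have "norm (y n) \<le> (\<Sum>j. norm (partial_sum n (X j)))"
    unfolding y_def by (rule summable_norm[OF sp])
  also have "\<dots> \<le> suminf k"
    by (rule suminf_le[OF _ sp \<open>summable k\<close>]) (rule k)
  finally show ?thesis .
qed

text \<open>Successive approximation as in the open mapping theorem: the remainders shrink like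
  \<open>r / 2^j\<close> and the approximants have partial sums bounded by \<open>k / 2^j\<close>,
  so \<open>x\<close> is a series whose bounds add up to \<open>2 * k\<close>.\<close>

lemma partial_sum_bounded: "\<exists>B>0. \<forall>x n. norm (partial_sum n x) \<le> B * norm x"
proof -
  obtain r k where rk: "r > 0" "k \<ge> 0"
    and approx: "\<And>y \<epsilon>. norm y < r \<Longrightarrow> 0 < \<epsilon> \<Longrightarrow> \<exists>w. (\<forall>n. norm (partial_sum n w) \<le> k) \<and> norm (y - w) < \<epsilon>"
    using approx_by_bounded_partial_sums by metis
  have unit: "norm (partial_sum n x) \<le> 2 * k" if x: "norm x < r" for x n
  proof -
    \<comment> \<open>The approximation for vectors shorter than \<open>r\<close> is applied to
      \<open>2^j *\<^sub>R y\<close> with error \<open>r / 2\<close> and scaled back;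
      \<open>z\<close> is the new remainder.\<close>
    have step: "\<exists>z. norm z < r * (1/2) ^ Suc j \<and> (\<forall>n. norm (partial_sum n (y - z)) \<le> k * (1/2) ^ j)"
      if y: "norm y < r * (1/2) ^ j" for y :: 'a and j
    proof -
      have "norm (2 ^ j *\<^sub>R y) < r"
        using y by (simp add: field_simps power_divide)
      then obtain w where w: "\<forall>n. norm (partial_sum n w) \<le> k" "norm (2 ^ j *\<^sub>R y - w) < r / 2"
        using approx[of "2 ^ j *\<^sub>R y" "r / 2"] rk by auto
      define u where "u = (1/2) ^ j *\<^sub>R w"
      have "norm (partial_sum n u) \<le> k * (1/2) ^ j" for n
        using w(1) by (simp add: u_def linear_scale[OF linear_partial_sum] power_divide divide_right_mono)
      moreover have "y - u = (1/2) ^ j *\<^sub>R (2 ^ j *\<^sub>R y - w)"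
        by (simp add: u_def scaleR_diff_right power_divide)
      then have "norm (y - u) = (1/2) ^ j * norm (2 ^ j *\<^sub>R y - w)"
        by (simp add: power_divide)
      then have "norm (y - u) < r * (1/2) ^ Suc j"
        using w(2) by (simp add: power_divide field_simps)
      ultimately show ?thesis
        by (intro exI[of _ "y - u"]) simp
    qed
    have "\<exists>R. \<forall>j. (norm (R j) < r * (1/2) ^ j \<and> (j = 0 \<longrightarrow> R j = x)) \<and>
        (\<forall>n. norm (partial_sum n (R j - R (Suc j))) \<le> k * (1/2) ^ j)"
    proof (rule dependent_nat_choice[where P="\<lambda>j y. norm y < r * (1/2) ^ j \<and> (j = 0 \<longrightarrow> y = x)"
          and Q="\<lambda>j y z. \<forall>n. norm (partial_sum n (y - z)) \<le> k * (1/2) ^ j"])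
      show "\<exists>y. norm y < r * (1/2) ^ 0 \<and> (0 = (0::nat) \<longrightarrow> y = x)"
        using x by simp
      fix y j
      assume "norm y < r * (1/2) ^ j \<and> (j = 0 \<longrightarrow> y = x)"
      with step[of y j] show "\<exists>z. (norm z < r * (1/2) ^ Suc j \<and> (Suc j = 0 \<longrightarrow> z = x)) \<and>
          (\<forall>n. norm (partial_sum n (y - z)) \<le> k * (1/2) ^ j)"
        by blast
    qed
    then obtain R where R: "\<And>j. norm (R j) < r * (1/2) ^ j" "R 0 = x"
      "\<And>j n. norm (partial_sum n (R j - R (Suc j))) \<le> k * (1/2) ^ j"
      by blast
    have "(\<lambda>j. r * (1/2::real) ^ j) \<longlonglongrightarrow> 0"
      by (rule tendsto_mult_right_zero[OF LIMSEQ_power_zero]) simp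
    moreover have "\<forall>\<^sub>F j in sequentially. norm (R j) \<le> r * (1/2) ^ j"
      using R(1) by (intro always_eventually allI less_imp_le)
    ultimately have "R \<longlonglongrightarrow> 0"
      by (rule Lim_null_comparison[rotated])
    \<comment> \<open>Consecutive remainders differ by the approximants, so the series telescopes to
      \<open>R 0 = x\<close>.\<close>
    then have "(\<lambda>j. R j - R (Suc j)) sums x"
      using telescope_sums'[of R 0] R(2) by simp
    from partial_sum_series_bound[OF R(3) _ this]
    show ?thesis
      by (simp add: summable_mult suminf_mult suminf_geometric mult.commute)
  qed
  show ?thesis
  proof (intro exI conjI allI)
    \<comment> \<open>Scaling \<open>x\<close> to length \<open>r / 2\<close> gives the factor
      \<open>4 * k / r\<close>; the added 1 makes the constant positive even for
      \<open>k = 0\<close>.\<close>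
    show "0 < 4 * (k + 1) / r" using rk by simp
    fix x n
    show "norm (partial_sum n x) \<le> 4 * (k + 1) / r * norm x"
    proof (cases "x = 0")
      case True
      then show ?thesis by (simp add: linear_0[OF linear_partial_sum])
    next
      case False
      define c where "c = r / (2 * norm x)"
      have c: "c > 0" using rk False by (simp add: c_def)
      have "norm (c *\<^sub>R x) < r" using rk False by (simp add: c_def)
      from unit[OF this, of n] have "c * norm (partial_sum n x) \<le> 2 * k"
        using c by (simp add: linear_scale[OF linear_partial_sum])
      then have "norm (partial_sum n x) \<le> 2 * k / c"
        using c by (simp add: field_simps)
      also have "\<dots> \<le> 4 * (k + 1) / r * norm x"
        using rk False by (simp add: c_def field_simps)
      finally show ?thesis .
    qed
  qed
qed

section \<open>Biorthogonal functionals\<close>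

text \<open>A coordinate times \<open>e i\<close> is a difference of two partial sums, and the norms
  of the \<open>e i\<close> stay above their positive infimum. This makes the bound uniform in
  \<open>i\<close>, which keeps the fundamental function of the functionals finite.\<close>

lemma coord_functionals:
  assumes "semi_normalized e"
  obtains f :: "nat \<Rightarrow> 'a \<Rightarrow>\<^sub>L real" and M where
    "\<And>i x. blinfun_apply (f i) x = coord x i" "\<And>i. norm (f i) \<le> M" "M > 0"
proof -
  obtain B where B: "B > 0" "\<And>x n. norm (partial_sum n x) \<le> B * norm x"
    using partial_sum_bounded by blast
  define c where "c = (INF i. norm (e i))"
  have c: "c > 0" using assms by (simp add: semi_normalized_def c_def)
  have ce: "c \<le> norm (e i)" for i
    unfolding c_def by (rule cINF_lower) (auto intro: bdd_belowI[of _ 0])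
  have bound: "norm (coord x i) \<le> norm x * (2 * B / c)" for x i
  proof -
    have "norm (coord x i) * c \<le> norm (coord x i) * norm (e i)"
      by (intro mult_left_mono ce) simp
    also have "\<dots> \<le> 2 * (B * norm x)"
      using coord_bound[OF B(2), of x i] by simp
    finally show ?thesis using c by (simp add: field_simps)
  qed
  have bl: "bounded_linear (\<lambda>x. coord x i)" for i
    by (rule bounded_linear_intro[OF _ _ bound]) (simp_all add: coord_add coord_scaleR)
  show ?thesis
  proof (rule that)
    show "blinfun_apply (Blinfun (\<lambda>x. coord x i)) x = coord x i" for i x
      using bl by (simp add: bounded_linear_Blinfun_apply)
    show "norm (Blinfun (\<lambda>x. coord x i)) \<le> 2 * B / c" for i
      using bound B c by (intro norm_blinfun_bound) (auto simp: bounded_linear_Blinfun_apply[OF bl] mult.commute)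
    show "2 * B / c > 0" using B c by simp
  qed
qed

text \<open>A continuous functional can be applied to the expansion of \<open>x\<close> term by
  term, so its values on the \<open>e j\<close> determine it; this justifies the definite
  description.\<close>

lemma biorthogonal_eq:
  assumes f: "\<And>i x. blinfun_apply (f i) x = coord x i"
  shows "biorthogonal e i = f i"
  unfolding biorthogonal_def
proof (rule the_equality)
  show "\<forall>j. blinfun_apply (f i) (e j) = (if i = j then 1 else 0)"
    by (simp add: f coord_basis)
  fix g :: "'a \<Rightarrow>\<^sub>L real"
  assume g: "\<forall>j. blinfun_apply g (e j) = (if i = j then 1 else 0)"
  show "g = f i"
  proof (rule blinfun_eqI)
    fix x
    have "(\<lambda>j. blinfun_apply g (coord x j *\<^sub>R e j)) sums blinfun_apply g x"
      by (rule bounded_linear.sums[OF blinfun.bounded_linear_right coord_sums])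
    moreover have "(\<lambda>j. blinfun_apply g (coord x j *\<^sub>R e j)) = (\<lambda>j. if j = i then coord x j else 0)"
      by (auto simp: blinfun.scaleR_right g)
    ultimately show "blinfun_apply g x = blinfun_apply (f i) x"
      using sums_unique2[OF _ sums_single[of i "coord x"]] by (simp add: f)
  qed
qed

section \<open>The multiplication in coordinates\<close>

lemma inj_e: "inj e"
proof (rule injI)
  fix i j assume "e i = e j"
  then have "coord (e i) i = coord (e j) i" by simp
  then show "i = j" by (simp add: coord_basis split: if_splits)
qed

lemma linear_coord: "linear (\<lambda>x. coord x i)"
  by (rule linearI) (simp_all add: coord_add coord_scaleR)

text \<open>Together with \<open>inj_e\<close> this lets \<open>representation\<close> recover the
  coefficients of a finite combination. The \<open>i\<close>-th coordinate vanishes on the span of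
  the other basis vectors but not at \<open>e i\<close>.\<close>

lemma independent_e: "independent (range e)"
proof
  assume "dependent (range e)"
  then obtain i where i: "e i \<in> span (range e - {e i})"
    unfolding dependent_def by blast
  have "coord (e i) i = 0"
    by (rule linear_eq_0_on_span[OF linear_coord _ i]) (auto simp: coord_basis)
  then show False by (simp add: coord_basis)
qed

lemma coeff_at_eq: "coeff_at e (\<Sum>i<n. a i *\<^sub>R e i) j = (if j < n then a j else 0)"
proof -
  have "coeff_at e (\<Sum>i<n. a i *\<^sub>R e i) j = (\<Sum>i<n. a i * (if e i = e j then 1 else 0))"
    unfolding coeff_at_def
    by (subst representation_sum[OF independent_e])
      (auto simp: span_base span_scale representation_scale[OF independent_e]
        representation_basis[OF independent_e] intro!: sum.cong)
  also have "\<dots> = (\<Sum>i<n. if i = j then a i else 0)"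
    using inj_e by (intro sum.cong) (auto simp: inj_eq)
  finally show ?thesis by (simp add: sum.delta')
qed

lemma support_length_eq:
  assumes "n > 0" "a (n - 1) \<noteq> 0"
  shows "support_length e (\<Sum>i<n. a i *\<^sub>R e i) = n"
  unfolding support_length_def
proof (rule Least_equality)
  fix y assume *: "\<forall>i\<ge>y. coeff_at e (\<Sum>i<n. a i *\<^sub>R e i) i = 0"
  show "n \<le> y"
  proof (rule ccontr)
    assume "\<not> n \<le> y"
    then have "coeff_at e (\<Sum>i<n. a i *\<^sub>R e i) (n - 1) = 0"
      using * by auto
    then show False using assms by (simp add: coeff_at_eq)
  qed
qed (simp add: coeff_at_eq)

text \<open>The nonzero last coefficients make the support lengths equal to \<open>n\<close> and
  \<open>m\<close>, so the blocks have length exactly \<open>m\<close> and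
  \<open>k = i * m + j\<close> is inverted by \<open>div\<close> and \<open>mod\<close>.\<close>

lemma seq_mult_eq:
  assumes "n > 0" "a (n - 1) \<noteq> 0" "m > 0" "b (m - 1) \<noteq> 0"
  shows "seq_mult e (\<Sum>i<n. a i *\<^sub>R e i) (\<Sum>j<m. b j *\<^sub>R e j) =
    (\<Sum>k<n*m. (a (k div m) * b (k mod m)) *\<^sub>R e k)"
proof -
  have "seq_mult e (\<Sum>i<n. a i *\<^sub>R e i) (\<Sum>j<m. b j *\<^sub>R e j)
     = (\<Sum>i<n. \<Sum>j<m. (a i * b j) *\<^sub>R e (i * m + j))"
    using support_length_eq[where a=a, OF assms(1,2)] support_length_eq[where a=b, OF assms(3,4)]
    by (simp add: seq_mult_def coeff_at_eq scaleR_sum_right)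
  also have "\<dots> = (\<Sum>k<n*m. (a (k div m) * b (k mod m)) *\<^sub>R e k)"
    by (simp flip: sum_div_mod)
  finally show ?thesis .
qed

end

section \<open>Quasi-multiplicative functions\<close>

lemma nonpos_if_multiples_bounded:
  fixes a b :: real
  assumes "\<And>j::nat. j \<ge> 1 \<Longrightarrow> real j * a \<le> b"
  shows "a \<le> 0"
proof (rule ccontr)
  assume "\<not> a \<le> 0"
  then have a: "a > 0" by simp
  then obtain j :: nat where j: "\<bar>b\<bar> < real j * a" using reals_Archimedean3 by blast
  then have "j \<ge> 1" by (cases j) auto
  with assms[of j] j show False by simp
qed

text \<open>On the logarithmic scale the function is additive up to \<open>k = ln K\<close> and
  increasing up to \<open>ln C\<close>. Comparing powers of \<open>n\<close> and \<open>m\<close>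
  shows that no quotient \<open>(f n - k) / ln n\<close> exceeds any
  \<open>(f m + k) / ln m\<close>. The supremum \<open>s\<close> of the former separates the two
  families and is the exponent.\<close>

lemma quasi_multiplicative_power_law:
  fixes \<phi> :: "nat \<Rightarrow> real"
  assumes pos: "\<And>n. n \<ge> 1 \<Longrightarrow> \<phi> n > 0"
    and mono: "\<And>n m. 1 \<le> n \<Longrightarrow> n \<le> m \<Longrightarrow> \<phi> n \<le> C * \<phi> m"
    and mult_le: "\<And>n m. 1 \<le> n \<Longrightarrow> 1 \<le> m \<Longrightarrow> \<phi> (n * m) \<le> K * \<phi> n * \<phi> m"
    and mult_ge: "\<And>n m. 1 \<le> n \<Longrightarrow> 1 \<le> m \<Longrightarrow> \<phi> n * \<phi> m \<le> K * \<phi> (n * m)"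
    and linear: "\<And>n. 1 \<le> n \<Longrightarrow> \<phi> n \<le> M * real n"
    and C: "C > 0" and K: "K > 0" and M: "M > 0"
  obtains s where "0 \<le> s" "s \<le> 1"
    "\<And>n. n \<ge> 1 \<Longrightarrow> \<phi> n \<le> K * real n powr s" "\<And>n. n \<ge> 1 \<Longrightarrow> real n powr s \<le> K * \<phi> n"
proof -
  define f k where "f n = ln (\<phi> n)" and "k = ln K" for n
  have fmono: "f n \<le> ln C + f m" if "1 \<le> n" "n \<le> m" for n m
    using mono[OF that] pos[of n] pos[of m] that C
    by (metis f_def le_trans ln_mult_pos ln_le_cancel_iff mult_pos_pos)
  have fle: "f (n * m) \<le> k + f n + f m" if "1 \<le> n" "1 \<le> m" for n m
  proof -
    have "f (n * m) \<le> ln (K * \<phi> n * \<phi> m)"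
      using mult_le[OF that] pos[of "n * m"] that by (simp add: f_def)
    then show ?thesis using pos[of n] pos[of m] that K by (simp add: ln_mult f_def k_def)
  qed
  have fge: "f n + f m \<le> k + f (n * m)" if "1 \<le> n" "1 \<le> m" for n m
  proof -
    have "ln (\<phi> n * \<phi> m) \<le> ln (K * \<phi> (n * m))"
      using mult_ge[OF that] pos[of n] pos[of m] that by (intro ln_mono) auto
    then show ?thesis using pos[of n] pos[of m] pos[of "n * m"] that K by (simp add: ln_mult f_def k_def)
  qed
  \<comment> \<open>The induction starts at \<open>n ^ 0 = 1\<close>, hence the term
    \<open>f 1\<close>; it cancels when \<open>pow_ge\<close> and \<open>pow_le\<close> are
    combined.\<close>
  have pow_le: "f (n ^ j) \<le> real j * (f n + k) + f 1" if "1 \<le> n" for n j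
  proof (induction j)
    case (Suc j)
    then show ?case using fle[of n "n ^ j"] that by (simp add: algebra_simps)
  qed simp
  have pow_ge: "real j * (f n - k) + f 1 \<le> f (n ^ j)" if "1 \<le> n" for n j
  proof (induction j)
    case (Suc j)
    then show ?case using fge[of n "n ^ j"] that by (simp add: algebra_simps)
  qed simp
  have compare: "(f n - k) / ln n \<le> (f m + k) / ln m" if "2 \<le> n" "2 \<le> m" for n m :: nat
  proof -
    define t where "t = ln (real n) / ln (real m)"
    have lpos: "ln (real n) > 0" "ln (real m) > 0" using that by auto
    then have t: "t > 0" by (simp add: t_def)
    have "(f n - k) - t * (f m + k) \<le> 0"
    proof (rule nonpos_if_multiples_bounded)
      fix j :: nat
      \<comment> \<open>Since \<open>t\<close> is the logarithm of \<open>n\<close> to base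
        \<open>m\<close>, rounding \<open>j * t\<close> up gives the least exponent with
        \<open>n ^ j \<le> m ^ l\<close>.\<close>
      define l where "l = nat \<lceil>real j * t\<rceil>"
      have l: "real j * t \<le> real l" "real l \<le> real j * t + 1"
        using t unfolding l_def by (simp_all add: of_nat_nat)
      have "ln (real (n ^ j)) \<le> ln (real (m ^ l))"
      proof -
        have "real j * ln (real n) = real j * t * ln (real m)" using lpos by (simp add: t_def)
        also have "\<dots> \<le> real l * ln (real m)" using l lpos by (intro mult_right_mono) auto
        finally show ?thesis using that by (simp add: ln_realpow)
      qed
      then have "real (n ^ j) \<le> real (m ^ l)"
        using that by (subst (asm) ln_le_cancel_iff) auto
      then have "n ^ j \<le> m ^ l" by (simp only: of_nat_le_iff)
      then have "f (n ^ j) \<le> ln C + f (m ^ l)" using that by (intro fmono) auto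
      then have "real j * (f n - k) \<le> ln C + real l * (f m + k)"
        using pow_ge[of n j] pow_le[of m l] that by linarith
      \<comment> \<open>Rounding changes the exponent by at most 1, so the error is bounded
        independently of \<open>j\<close> and vanishes on division by \<open>j\<close>.\<close>
      also have "real l * (f m + k) \<le> real j * t * (f m + k) + \<bar>f m + k\<bar>"
      proof -
        have "(real l - real j * t) * (f m + k) \<le> 1 * \<bar>f m + k\<bar>"
          using l by (intro order_trans[OF mult_left_mono[OF abs_ge_self] mult_right_mono]) auto
        then show ?thesis by (simp add: algebra_simps)
      qed
      finally show "real j * ((f n - k) - t * (f m + k)) \<le> ln C + \<bar>f m + k\<bar>"
        by (simp add: algebra_simps)
    qed
    then show ?thesis using lpos by (simp add: t_def field_simps)
  qed
  define s where "s = (SUP n\<in>{2::nat..}. (f n - k) / ln n)"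
  have bdd: "bdd_above ((\<lambda>n::nat. (f n - k) / ln n) ` {2..})"
    using compare[OF _ order_refl] by (intro bdd_aboveI2) auto
  have s_ge: "f n - k \<le> s * ln n" if "2 \<le> n" for n
  proof -
    have "(f n - k) / ln n \<le> s"
      unfolding s_def using that by (intro cSUP_upper bdd) auto
    then show ?thesis using that by (simp add: field_simps)
  qed
  have s_le: "s * ln n \<le> f n + k" if "2 \<le> n" for n
  proof -
    have "s \<le> (f n + k) / ln n"
      unfolding s_def using that compare by (intro cSUP_least) auto
    then show ?thesis using that by (simp add: field_simps)
  qed
  \<comment> \<open>Testing on powers of 2 turns the logarithms into unbounded multiples of
    \<open>ln 2\<close>.\<close>
  have ln_bounded: "a \<le> 0" if "\<And>n. n \<ge> 2 \<Longrightarrow> a * ln (real n) \<le> b" for a b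
  proof -
    have "a * ln 2 \<le> 0"
    proof (rule nonpos_if_multiples_bounded)
      fix j :: nat assume "j \<ge> 1"
      then have "2 \<le> (2::nat) ^ j" by (metis power_increasing power_one_right one_le_numeral)
      from that[OF this] show "real j * (a * ln 2) \<le> b" by (simp add: ln_realpow mult_ac)
    qed
    then show ?thesis by (simp add: mult_le_0_iff)
  qed
  \<comment> \<open>Almost monotonicity, compared with \<open>n = 1\<close>, rules out negative
    exponents; below, the linear growth bound rules out exponents above 1.\<close>
  have "- s \<le> 0"
  proof (rule ln_bounded)
    fix n :: nat assume "n \<ge> 2"
    then show "- s * ln (real n) \<le> ln C + k - f 1"
      using s_ge[of n] fmono[of 1 n] by simp
  qed
  moreover have "s - 1 \<le> 0"
  proof (rule ln_bounded)
    fix n :: nat assume n: "n \<ge> 2"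
    then have "f n \<le> ln (M * real n)"
      using linear[of n] pos[of n] by (simp add: f_def)
    then show "(s - 1) * ln (real n) \<le> ln M + k"
      using s_le[OF n] n M by (simp add: ln_mult algebra_simps)
  qed
  moreover have "\<phi> n \<le> K * real n powr s \<and> real n powr s \<le> K * \<phi> n" if n: "n \<ge> 1" for n
  proof (cases "n = 1")
    \<comment> \<open>The quotients exclude \<open>n = 1\<close> because \<open>ln 1 = 0\<close>;
      here quasi-multiplicativity at \<open>1 * 1\<close> gives both bounds.\<close>
    case True
    then show ?thesis
      using mult_le[of 1 1] mult_ge[of 1 1] pos[of 1] by (simp add: mult.assoc)
  next
    case False
    then have n2: "n \<ge> 2" using n by simp
    have "ln (\<phi> n) \<le> ln (K * real n powr s)"
      using s_ge[OF n2] n K by (simp add: ln_mult f_def k_def ln_powr)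
    moreover have "ln (real n powr s) \<le> ln (K * \<phi> n)"
      using s_le[OF n2] n K pos[OF n] by (simp add: ln_mult f_def k_def ln_powr)
    moreover have "0 < real n powr s" "0 < K * \<phi> n" "0 < K * real n powr s"
      using n K pos[OF n] by simp_all
    ultimately show ?thesis using pos[OF n] by (simp only: ln_le_cancel_iff)
  qed
  ultimately show ?thesis using that[of s] by auto
qed

text \<open>If \<open>u > w\<close>, division by \<open>u ^ N\<close> bounds \<open>c > 0\<close> by
  a polynomial in \<open>N\<close> times a decaying geometric sequence, which tends to 0.\<close>

lemma le_if_powers_le_polynomially:
  fixes u w c E :: real
  assumes "n > 0" "c > 0" "u \<ge> 0" "w \<ge> 0"
    and le: "\<And>N. u ^ N * c \<le> E * real (Suc N) ^ n * w ^ N"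
  shows "u \<le> w"
proof (rule ccontr)
  assume "\<not> u \<le> w"
  then have u: "u > w" by simp
  define q where "q = w / u"
  have q: "0 \<le> q" "q < 1" using u assms by (simp_all add: q_def)
  have "c \<le> E * (real (Suc N) ^ n * q ^ N)" for N
    using le[of N] u assms by (simp add: q_def power_divide field_simps)
  moreover have "(\<lambda>N. E * (real (Suc N) ^ n * q ^ N)) \<longlonglongrightarrow> 0"
  proof -
    \<comment> \<open>With the \<open>n\<close>-th root of \<open>q\<close>, the whole term is the
      \<open>n\<close>-th power of \<open>(N + 1) * r ^ N\<close>, which reduces the limit to a
      linear factor.\<close>
    define r where "r = root n q"
    have r: "0 \<le> r" "r < 1" "r ^ n = q" using q \<open>n > 0\<close> by (simp_all add: r_def)
    have "(\<lambda>N. real N * r ^ N + r ^ N) \<longlonglongrightarrow> 0 + 0"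
      using r by (intro tendsto_add powser_times_n_limit_0 LIMSEQ_power_zero) auto
    then have "(\<lambda>N. E * (real N * r ^ N + r ^ N) ^ n) \<longlonglongrightarrow> E * 0 ^ n"
      by (intro tendsto_mult tendsto_const tendsto_power) simp
    moreover have "(real N * r ^ N + r ^ N) ^ n = real (Suc N) ^ n * q ^ N" for N
    proof -
      have "real N * r ^ N + r ^ N = real (Suc N) * r ^ N" by (simp add: algebra_simps)
      moreover have "(r ^ N) ^ n = q ^ N" by (metis r(3) power_commutes power_mult mult.commute)
      ultimately show ?thesis by (simp add: power_mult_distrib del: of_nat_Suc)
    qed
    ultimately show ?thesis using \<open>n > 0\<close> by (simp add: zero_power)
  qed
  ultimately have "c \<le> 0"
    by (intro LIMSEQ_le_const) auto
  then show False using \<open>c > 0\<close> by simp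
qed

section \<open>Tensor powers of coefficient sequences\<close>

text \<open>For \<open>k < n ^ N\<close> this is the product of \<open>a\<close> over the
  \<open>N\<close> base-\<open>n\<close> digits of \<open>k\<close>. The leading digit is split off,
  so the new factor stands on the left of the multiplication.\<close>

fun tensor_power :: "(nat \<Rightarrow> real) \<Rightarrow> nat \<Rightarrow> nat \<Rightarrow> nat \<Rightarrow> real" where
  "tensor_power a n 0 = (\<lambda>_. 1)"
| "tensor_power a n (Suc N) = (\<lambda>k. a (k div n ^ N) * tensor_power a n N (k mod n ^ N))"

text \<open>All base-\<open>n\<close> digits of \<open>n ^ N - 1\<close> equal \<open>n - 1\<close>.
  This provides the nonzero last coefficient that \<open>seq_mult_eq\<close> requires at the next
  power.\<close>

lemma tensor_power_last:
  assumes "n > 0" "a (n - 1) \<noteq> 0"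
  shows "tensor_power a n N (n ^ N - 1) \<noteq> 0"
proof (induction N)
  case (Suc N)
  have p: "n ^ N > 0" using assms by simp
  have "n * n ^ N - 1 = (n - 1) * n ^ N + (n ^ N - 1)"
    using assms p by (cases n) (auto simp: algebra_simps)
  moreover have "((n - 1) * n ^ N + (n ^ N - 1)) div n ^ N = n - 1"
    "((n - 1) * n ^ N + (n ^ N - 1)) mod n ^ N = n ^ N - 1"
    using p by (simp_all only: div_mult_self3 mod_mult_self3) simp_all
  ultimately have "(n * n ^ N - 1) div n ^ N = n - 1" "(n * n ^ N - 1) mod n ^ N = n ^ N - 1"
    by metis+
  then show ?case using Suc assms by simp
qed simp

text \<open>A product over digits depends only on how often each value of \<open>a\<close> occurs.
  With at most \<open>n\<close> values and multiplicities between 0 and \<open>N\<close>, at most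
  \<open>(N + 1) ^ n\<close> products arise.\<close>

lemma tensor_power_values:
  assumes "n > 0"
  shows "card (tensor_power a n N ` {..<n ^ N}) \<le> Suc N ^ n"
proof -
  define V where "V = a ` {..<n}"
  have V: "finite V" by (simp add: V_def)
  define G where "G N = (\<lambda>c. \<Prod>v\<in>V. v ^ c v) ` (V \<rightarrow>\<^sub>E {..N})" for N :: nat
  have "tensor_power a n N ` {..<n ^ N} \<subseteq> G N"
  proof (induction N)
    case 0
    have "restrict (\<lambda>_. 0) V \<in> V \<rightarrow>\<^sub>E {..0::nat}" by auto
    then have "(\<Prod>v\<in>V. v ^ (restrict (\<lambda>_. 0) V v :: nat)) \<in> G 0" unfolding G_def by (rule imageI)
    then show ?case by auto
  next
    case (Suc N)
    show ?case
    proof (clarify)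
      fix k assume k: "k < n ^ Suc N"
      have "tensor_power a n N (k mod n ^ N) \<in> G N"
        using Suc assms by auto
      then obtain c where c: "c \<in> V \<rightarrow>\<^sub>E {..N}" "tensor_power a n N (k mod n ^ N) = (\<Prod>v\<in>V. v ^ c v)"
        unfolding G_def by blast
      define w where "w = a (k div n ^ N)"
      have w: "w \<in> V" using k by (simp add: w_def V_def less_mult_imp_div_less)
      \<comment> \<open>The new leading digit raises the multiplicity of its value by one.\<close>
      define c' where "c' = c(w := Suc (c w))"
      have "c' \<in> V \<rightarrow>\<^sub>E {..Suc N}"
      proof (rule PiE_I)
        show "c' v \<in> {..Suc N}" if "v \<in> V" for v
          using PiE_mem[OF c(1) that] by (auto simp: c'_def)
        show "c' v = undefined" if "v \<notin> V" for v
          using PiE_arb[OF c(1) that] that w by (auto simp: c'_def)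
      qed
      moreover have "(\<Prod>v\<in>V. v ^ c' v) = w * (\<Prod>v\<in>V. v ^ c v)"
        using prod.remove[OF V w, of "\<lambda>v. v ^ c' v"] prod.remove[OF V w, of "\<lambda>v. v ^ c v"]
        by (simp add: c'_def)
      ultimately show "tensor_power a n (Suc N) k \<in> G (Suc N)"
        unfolding G_def using c(2) by (auto simp: w_def intro!: image_eqI[of _ _ c'])
    qed
  qed
  moreover have fin: "finite (V \<rightarrow>\<^sub>E {..N})" using V by (intro finite_PiE) auto
  ultimately have "card (tensor_power a n N ` {..<n ^ N}) \<le> card (G N)"
    by (intro card_mono) (auto simp: G_def)
  also have "\<dots> \<le> card (V \<rightarrow>\<^sub>E {..N})"
    unfolding G_def by (rule card_image_le[OF fin])
  also have "\<dots> = Suc N ^ card V" using V by (simp add: card_funcsetE)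
  also have "\<dots> \<le> Suc N ^ n"
    using card_image_le[of "{..<n}" a] by (intro power_increasing) (auto simp: V_def)
  finally show ?thesis .
qed

text \<open>The exponent is \<open>p = 1 / s\<close>, with \<open>s = 0\<close> standing for \<open>p = \<infinity>\<close>.\<close>

definition fin_norm :: "real \<Rightarrow> (nat \<Rightarrow> real) \<Rightarrow> nat \<Rightarrow> real" where
  "fin_norm s x n =
     (if s = 0 then Max ((\<lambda>i. \<bar>x i\<bar>) ` {..<n}) else (\<Sum>i<n. \<bar>x i\<bar> powr (1 / s)) powr s)"

lemma fin_norm_nonneg:
  assumes "n > 0"
  shows "fin_norm s x n \<ge> 0"
proof -
  have "\<bar>x 0\<bar> \<le> Max ((\<lambda>i. \<bar>x i\<bar>) ` {..<n})"
    using assms by (intro Max_ge) auto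
  then show ?thesis by (simp add: fin_norm_def order_trans[OF abs_ge_zero])
qed

text \<open>The index pairs run over a full rectangle, so the sum of products factors and the
  maximum is attained at a pair of maximizers. Unlike for the norm of the space, no constant is
  lost.\<close>

lemma fin_norm_div_mod:
  assumes "n > 0" "m > 0"
  shows "fin_norm s (\<lambda>k. a (k div m) * b (k mod m)) (n * m) = fin_norm s a n * fin_norm s b m"
proof (cases "s = 0")
  case True
  have "Max ((\<lambda>k. \<bar>a (k div m) * b (k mod m)\<bar>) ` {..<n * m})
      = Max ((\<lambda>i. \<bar>a i\<bar>) ` {..<n}) * Max ((\<lambda>i. \<bar>b i\<bar>) ` {..<m})" (is "_ = ?A * ?B")
  proof (rule Max_eqI)
    fix y assume "y \<in> (\<lambda>k. \<bar>a (k div m) * b (k mod m)\<bar>) ` {..<n * m}"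
    then obtain k where k: "k < n * m" "y = \<bar>a (k div m)\<bar> * \<bar>b (k mod m)\<bar>"
      by (auto simp: abs_mult)
    have "\<bar>a (k div m)\<bar> \<le> ?A" "\<bar>b (k mod m)\<bar> \<le> ?B"
      using k assms by (auto simp: less_mult_imp_div_less intro!: Max_ge)
    then show "y \<le> ?A * ?B"
      unfolding k(2) by (rule mult_mono') auto
  next
    have "?A \<in> (\<lambda>i. \<bar>a i\<bar>) ` {..<n}" "?B \<in> (\<lambda>i. \<bar>b i\<bar>) ` {..<m}"
      using assms by (intro Max_in; auto)+
    then obtain i j where ij: "i < n" "?A = \<bar>a i\<bar>" "j < m" "?B = \<bar>b j\<bar>" by blast
    have "i * m + j < (i + 1) * m" using ij by simp
    also have "\<dots> \<le> n * m" using ij by (intro mult_right_mono) auto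
    finally show "?A * ?B \<in> (\<lambda>k. \<bar>a (k div m) * b (k mod m)\<bar>) ` {..<n * m}"
      using ij by (intro image_eqI[of _ _ "i * m + j"]) (auto simp: abs_mult)
  qed simp
  then show ?thesis by (simp add: fin_norm_def True)
next
  case False
  have "(\<Sum>k<n * m. \<bar>a (k div m) * b (k mod m)\<bar> powr (1 / s))
      = (\<Sum>i<n. \<bar>a i\<bar> powr (1 / s)) * (\<Sum>j<m. \<bar>b j\<bar> powr (1 / s))"
    by (simp add: abs_mult powr_mult sum_product
        sum_div_mod[of "\<lambda>i j. \<bar>a i\<bar> powr (1 / s) * \<bar>b j\<bar> powr (1 / s)"])
  then show ?thesis by (simp add: fin_norm_def False powr_mult sum_nonneg)
qed

lemma fin_norm_tensor_power:
  assumes "n > 0"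
  shows "fin_norm s (tensor_power a n N) (n ^ N) = fin_norm s a n ^ N"
proof (induction N)
  case 0
  show ?case by (simp add: fin_norm_def lessThan_Suc)
next
  case (Suc N)
  then show ?case using fin_norm_div_mod[of n "n ^ N" s a "tensor_power a n N"] assms by simp
qed

section \<open>Level sets and the \<open>fin_norm\<close>\<close>

abbreviation level :: "(nat \<Rightarrow> real) \<Rightarrow> nat \<Rightarrow> real \<Rightarrow> nat set" where
  "level x n v \<equiv> {i\<in>{..<n}. x i = v}"

lemma card_level_pos: "v \<in> x ` {..<n} \<Longrightarrow> card (level x n v) > 0"
  by (subst card_gt_0_iff) auto

lemma sum_powr_level:
  "(\<Sum>i<n. \<bar>x i\<bar> powr p) = (\<Sum>v\<in>x ` {..<n}. real (card (level x n v)) * \<bar>v\<bar> powr p)"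
proof -
  have "(\<Sum>i<n. \<bar>x i\<bar> powr p) = (\<Sum>v\<in>x ` {..<n}. \<Sum>i\<in>level x n v. \<bar>x i\<bar> powr p)"
    by (rule sum.image_gen) simp
  then show ?thesis by simp
qed

text \<open>A single level set contributes one nonnegative term to the sum of
  \<open>1 / s\<close>-th powers, and for \<open>s = 0\<close> one entry to the maximum.\<close>

lemma level_le_fin_norm:
  assumes v: "v \<in> x ` {..<n}" and "s \<ge> 0"
  shows "\<bar>v\<bar> * real (card (level x n v)) powr s \<le> fin_norm s x n"
proof (cases "s = 0")
  case True
  then show ?thesis
    using v card_level_pos[OF v] by (auto simp: fin_norm_def intro!: Max_ge)
next
  case False
  then have s: "s > 0" using assms by simp
  have "real (card (level x n v)) * \<bar>v\<bar> powr (1 / s) \<le> (\<Sum>i<n. \<bar>x i\<bar> powr (1 / s))"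
    unfolding sum_powr_level using v by (intro member_le_sum) auto
  then have "(real (card (level x n v)) * \<bar>v\<bar> powr (1 / s)) powr s \<le> fin_norm s x n"
    unfolding fin_norm_def using s by (auto intro!: powr_mono2)
  then show ?thesis using s by (simp add: powr_mult powr_powr mult.commute)
qed

text \<open>Each distinct value contributes at most \<open>B powr (1 / s)\<close> to the sum; taking
  the power \<open>s \<le> 1\<close> leaves at most the number of values as a factor.\<close>

lemma fin_norm_le_level:
  assumes n: "n > 0" and s: "0 \<le> s" "s \<le> 1"
    and B: "\<And>v. v \<in> x ` {..<n} \<Longrightarrow> \<bar>v\<bar> * real (card (level x n v)) powr s \<le> B"
  shows "fin_norm s x n \<le> real (card (x ` {..<n})) * B"
proof -
  let ?V = "x ` {..<n}"
  have card: "real (card ?V) \<ge> 1" using n by (auto simp: Suc_le_eq card_gt_0_iff)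
  have B0: "B \<ge> 0"
    using B[of "x 0"] n by (auto intro: order_trans[rotated])
  show ?thesis
  proof (cases "s = 0")
    case True
    have "\<bar>x i\<bar> \<le> B" if "i < n" for i
    proof -
      have "x i \<in> x ` {..<n}" using that by simp
      \<comment> \<open>\<open>0 powr 0\<close> is 0, so the cardinality factor equals 1 only
        because the level set is nonempty.\<close>
      from B[OF this] card_level_pos[OF this] show ?thesis
        by (simp only: True powr_zero_eq_one of_nat_0_less_iff less_imp_neq[symmetric]) (simp split: if_splits)
    qed
    then have "fin_norm s x n \<le> B" using n by (auto simp: fin_norm_def True intro!: Max.boundedI)
    also have "\<dots> \<le> real (card ?V) * B" using card B0 by (simp add: mult_le_cancel_right1)
    finally show ?thesis .
  next
    case False
    then have s: "0 < s" "s \<le> 1" using s by auto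
    have "(\<Sum>i<n. \<bar>x i\<bar> powr (1 / s)) \<le> (\<Sum>v\<in>?V. B powr (1 / s))"
      unfolding sum_powr_level
    proof (rule sum_mono)
      fix v assume "v \<in> ?V"
      then have "(\<bar>v\<bar> * real (card (level x n v)) powr s) powr (1 / s) \<le> B powr (1 / s)"
        using B s by (intro powr_mono2) auto
      then show "real (card (level x n v)) * \<bar>v\<bar> powr (1 / s) \<le> B powr (1 / s)"
        using s by (simp add: powr_mult powr_powr mult.commute)
    qed
    then have "fin_norm s x n \<le> (real (card ?V) * B powr (1 / s)) powr s"
      using s by (auto simp: fin_norm_def intro!: powr_mono2 sum_nonneg)
    also have "\<dots> = real (card ?V) powr s * B"
      using s B0 by (simp add: powr_mult powr_powr)
    also have "\<dots> \<le> real (card ?V) powr 1 * B"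
      using s B0 card by (intro mult_right_mono powr_mono) auto
    finally show ?thesis using card by simp
  qed
qed

section \<open>Fundamental functions and multiplicative norms\<close>

lemma norm_sum_le_card:
  fixes f :: "nat \<Rightarrow> 'b::real_normed_vector"
  assumes M: "\<And>i. norm (f i) \<le> M" and A: "card A \<le> n"
  shows "norm (sum f A) \<le> M * real n"
proof -
  have "M \<ge> 0" using M[of 0] norm_ge_zero order_trans by blast
  have "norm (sum f A) \<le> real (card A) * M"
    using sum_norm_bound[of A f M] M by simp
  also have "\<dots> \<le> M * real n"
    using A \<open>M \<ge> 0\<close> by (simp add: mult.commute mult_left_mono)
  finally show ?thesis .
qed

text \<open>The uniform bound \<open>M\<close> keeps the set under \<open>Sup\<close> bounded above,
  so that the supremum is a genuine one.\<close>

lemma norm_sum_le_fundamental_function: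
  fixes f :: "nat \<Rightarrow> 'b::real_normed_vector"
  assumes M: "\<And>i. norm (f i) \<le> M" and A: "finite A" "card A \<le> n"
  shows "norm (sum f A) \<le> fundamental_function f n"
  unfolding fundamental_function_def
proof (rule cSup_upper)
  show "norm (sum f A) \<in> {norm (\<Sum>i\<in>A. f i) |A. finite A \<and> card A \<le> n}"
    using A by blast
  show "bdd_above {norm (\<Sum>i\<in>A. f i) |A. finite A \<and> card A \<le> n}"
  proof (rule bdd_aboveI)
    fix y assume "y \<in> {norm (\<Sum>i\<in>A. f i) |A. finite A \<and> card A \<le> n}"
    then show "y \<le> M * real n" using norm_sum_le_card[of f M _ n] M by auto
  qed
qed

lemma fundamental_function_leI:
  fixes f :: "nat \<Rightarrow> 'b::real_normed_vector"
  assumes "\<And>A. finite A \<Longrightarrow> card A \<le> n \<Longrightarrow> norm (sum f A) \<le> b"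
  shows "fundamental_function f n \<le> b"
  unfolding fundamental_function_def
proof (rule cSup_least)
  show "{norm (\<Sum>i\<in>A. f i) |A. finite A \<and> card A \<le> n} \<noteq> {}"
    by (auto intro!: exI[of _ "{}"])
  fix y assume "y \<in> {norm (\<Sum>i\<in>A. f i) |A. finite A \<and> card A \<le> n}"
  then show "y \<le> b" using assms by auto
qed

locale tensor_basis = schauder e for e :: "nat \<Rightarrow> 'a::banach" +
  fixes K :: real
  assumes semi_normalized: "semi_normalized e"
    and bidemocratic: "bidemocratic e"
    and K_pos: "K > 0"
    and mult_ge: "\<And>\<alpha> \<beta>. \<alpha> \<in> span (range e) \<Longrightarrow> \<beta> \<in> span (range e) \<Longrightarrow>
      norm \<alpha> * norm \<beta> \<le> K * norm (seq_mult e \<alpha> \<beta>)"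
    and mult_le: "\<And>\<alpha> \<beta>. \<alpha> \<in> span (range e) \<Longrightarrow> \<beta> \<in> span (range e) \<Longrightarrow>
      norm (seq_mult e \<alpha> \<beta>) \<le> K * norm \<alpha> * norm \<beta>"
begin

definition lincomb :: "(nat \<Rightarrow> real) \<Rightarrow> nat \<Rightarrow> 'a" where
  "lincomb a n = (\<Sum>i<n. a i *\<^sub>R e i)"

lemma lincomb_in_span: "lincomb a n \<in> span (range e)"
  unfolding lincomb_def by (intro span_sum span_scale span_base) auto

lemma norm_lincomb_div_mod:
  assumes "n > 0" "a (n - 1) \<noteq> 0" "m > 0" "b (m - 1) \<noteq> 0"
  defines "x \<equiv> lincomb (\<lambda>k. a (k div m) * b (k mod m)) (n * m)"
  shows "norm (lincomb a n) * norm (lincomb b m) \<le> K * norm x"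
    and "norm x \<le> K * norm (lincomb a n) * norm (lincomb b m)"
proof -
  have "x = seq_mult e (lincomb a n) (lincomb b m)"
    unfolding x_def lincomb_def using seq_mult_eq[where a=a and b=b, OF assms(1-4)] by simp
  then show "norm (lincomb a n) * norm (lincomb b m) \<le> K * norm x"
    and "norm x \<le> K * norm (lincomb a n) * norm (lincomb b m)"
    using mult_ge[OF lincomb_in_span lincomb_in_span] mult_le[OF lincomb_in_span lincomb_in_span] by auto
qed

text \<open>Each multiplication by the vector costs one factor \<open>K\<close>. The zeroth power
  has the single coefficient 1 and is the vector \<open>e 0\<close>.\<close>

lemma norm_lincomb_tensor_power:
  assumes "n > 0" "a (n - 1) \<noteq> 0"
  defines "x N \<equiv> lincomb (tensor_power a n N) (n ^ N)"
  shows "norm (lincomb a n) ^ N * norm (e 0) \<le> K ^ N * norm (x N)"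
    and "norm (x N) \<le> K ^ N * norm (lincomb a n) ^ N * norm (e 0)"
proof -
  have step: "norm (lincomb a n) * norm (x N) \<le> K * norm (x (Suc N))"
    "norm (x (Suc N)) \<le> K * norm (lincomb a n) * norm (x N)" for N
    using norm_lincomb_div_mod[of n a "n ^ N" "tensor_power a n N"] tensor_power_last[of n a N] assms
    by (simp_all add: x_def)
  show "norm (lincomb a n) ^ N * norm (e 0) \<le> K ^ N * norm (x N)"
  proof (induction N)
    case 0
    show ?case by (simp add: x_def lincomb_def lessThan_Suc)
  next
    case (Suc N)
    have "norm (lincomb a n) ^ Suc N * norm (e 0) = norm (lincomb a n) * (norm (lincomb a n) ^ N * norm (e 0))"
      by simp
    also have "\<dots> \<le> norm (lincomb a n) * (K ^ N * norm (x N))"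
      by (intro mult_left_mono Suc) simp
    also have "\<dots> = K ^ N * (norm (lincomb a n) * norm (x N))" by simp
    also have "\<dots> \<le> K ^ N * (K * norm (x (Suc N)))"
      using K_pos by (intro mult_left_mono step) simp
    finally show ?case by (simp add: mult_ac)
  qed
  show "norm (x N) \<le> K ^ N * norm (lincomb a n) ^ N * norm (e 0)"
  proof (induction N)
    case 0
    show ?case by (simp add: x_def lincomb_def lessThan_Suc)
  next
    case (Suc N)
    have "norm (x (Suc N)) \<le> K * norm (lincomb a n) * norm (x N)" by (rule step)
    also have "\<dots> \<le> K * norm (lincomb a n) * (K ^ N * norm (lincomb a n) ^ N * norm (e 0))"
      using K_pos by (intro mult_left_mono Suc) simp
    finally show ?case by (simp add: mult_ac)
  qed
qed

section \<open>Power law for \<open>\<Phi>\<close> and comparison with the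
  \<open>fin_norm\<close>\<close>

abbreviation \<Phi> :: "nat \<Rightarrow> real" where
  "\<Phi> \<equiv> fundamental_function e"

lemma norm_e_bounded: obtains M where "M > 0" "\<And>i. norm (e i) \<le> M"
proof -
  obtain M where M: "\<And>i. norm (e i) \<le> M"
    using semi_normalized unfolding semi_normalized_def bdd_above_def by auto
  moreover have "M > 0" using M[of 0] e_nonzero[of 0] by (meson less_le_trans zero_less_norm_iff)
  ultimately show ?thesis using that by blast
qed

lemma norm_sum_e_le: "finite A \<Longrightarrow> card A \<le> n \<Longrightarrow> norm (sum e A) \<le> \<Phi> n"
  using norm_e_bounded norm_sum_le_fundamental_function by metis

lemma \<Phi>_pos:
  assumes "n \<ge> 1"
  shows "\<Phi> n > 0"
proof -
  have "norm (sum e {0}) \<le> \<Phi> n" using assms by (intro norm_sum_e_le) auto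
  then show ?thesis using e_nonzero[of 0] less_le_trans[of 0 "norm (e 0)"] by simp
qed

lemma \<Phi>_mono: "n \<le> m \<Longrightarrow> \<Phi> n \<le> \<Phi> m"
  by (intro fundamental_function_leI norm_sum_e_le) auto

lemma coord_lincomb: "coord (lincomb a n) i = (if i < n then a i else 0)"
proof -
  have "coord (lincomb a n) i = (\<Sum>j<n. coord (a j *\<^sub>R e j) i)"
    unfolding lincomb_def by (rule linear_sum[OF linear_coord])
  also have "\<dots> = (\<Sum>j<n. if j = i then a j else 0)"
    by (intro sum.cong) (auto simp: coord_scaleR coord_basis)
  finally show ?thesis by simp
qed

text \<open>Testing against the sum of the coordinate functionals over a level set, whose norm
  bidemocracy bounds by \<open>C n / \<Phi> n\<close>.\<close>

lemma level_le_norm_lincomb: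
  obtains C where "C > 0"
    "\<And>a n v. v \<in> a ` {..<n} \<Longrightarrow> \<bar>v\<bar> * \<Phi> (card (level a n v)) \<le> C * norm (lincomb a n)"
proof -
  obtain f M where f: "\<And>i x. blinfun_apply (f i) x = coord x i" "\<And>i. norm (f i) \<le> M" "M > 0"
    using coord_functionals[OF semi_normalized] by metis
  have "biorthogonal e = f" using biorthogonal_eq[of f] f(1) by blast
  then obtain C where C: "C > 0"
    "\<And>n. n \<ge> 1 \<Longrightarrow> fundamental_function f n / C \<le> real n / \<Phi> n"
    using bidemocratic unfolding bidemocratic_def asymp_equiv_const_def by metis
  show ?thesis
  proof (rule that[OF C(1)])
    fix a :: "nat \<Rightarrow> real" and n v
    assume v: "v \<in> a ` {..<n}"
    define A where "A = level a n v"
    have A: "finite A" "card A \<ge> 1" using card_level_pos[OF v] by (auto simp: A_def)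
    have "blinfun_apply (sum f A) (lincomb a n) = real (card A) * v"
      by (simp add: blinfun.sum_left f(1) coord_lincomb A_def)
    then have "real (card A) * \<bar>v\<bar> \<le> norm (sum f A) * norm (lincomb a n)"
      using norm_blinfun[of "sum f A" "lincomb a n"] by (simp add: abs_mult)
    also have "\<dots> \<le> fundamental_function f (card A) * norm (lincomb a n)"
      by (intro mult_right_mono norm_sum_le_fundamental_function[OF f(2)] A) auto
    also have "\<dots> \<le> (C * (real (card A) / \<Phi> (card A))) * norm (lincomb a n)"
      using C(2)[OF A(2)] C(1) by (intro mult_right_mono) (simp_all add: field_simps)
    finally show "\<bar>v\<bar> * \<Phi> (card A) \<le> C * norm (lincomb a n)"
      using A \<Phi>_pos[OF A(2)] by (simp add: field_simps mult_le_cancel_left_pos)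
  qed
qed

text \<open>Grouping by value leaves one term per distinct coordinate, a number that
  \<open>tensor_power_values\<close> controls for tensor powers.\<close>

lemma norm_lincomb_le_level:
  "norm (lincomb a n) \<le> (\<Sum>v\<in>a ` {..<n}. \<bar>v\<bar> * \<Phi> (card (level a n v)))"
proof -
  have "lincomb a n = (\<Sum>v\<in>a ` {..<n}. \<Sum>i\<in>level a n v. a i *\<^sub>R e i)"
    unfolding lincomb_def by (rule sum.image_gen) simp
  also have "\<dots> = (\<Sum>v\<in>a ` {..<n}. v *\<^sub>R sum e (level a n v))"
    by (simp add: scaleR_sum_right)
  finally have "norm (lincomb a n) \<le> (\<Sum>v\<in>a ` {..<n}. norm (v *\<^sub>R sum e (level a n v)))"
    using norm_sum by metis
  also have "\<dots> \<le> (\<Sum>v\<in>a ` {..<n}. \<bar>v\<bar> * \<Phi> (card (level a n v)))"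
    by (intro sum_mono) (auto intro!: mult_left_mono norm_sum_e_le)
  finally show ?thesis .
qed

text \<open>The product of all-ones vectors of lengths \<open>n\<close> and \<open>m\<close> is the
  all-ones vector of length \<open>n * m\<close>, so their norms \<open>\<phi>\<close> are
  quasi-multiplicative. Bidemocracy, through \<open>level_le_norm_lincomb\<close> with the single
  level 1, makes \<open>\<phi>\<close> comparable to \<open>\<Phi>\<close>.\<close>

lemma \<Phi>_power_law:
  obtains s D where "0 \<le> s" "s \<le> 1" "D > 0"
    "\<And>n. n \<ge> 1 \<Longrightarrow> \<Phi> n \<le> D * real n powr s" "\<And>n. n \<ge> 1 \<Longrightarrow> real n powr s \<le> D * \<Phi> n"
proof -
  define \<phi> where "\<phi> n = norm (lincomb (\<lambda>_. 1) n)" for n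
  obtain C where C: "C > 0"
    "\<And>a n v. v \<in> a ` {..<n} \<Longrightarrow> \<bar>v\<bar> * \<Phi> (card (level a n v)) \<le> C * norm (lincomb a n)"
    using level_le_norm_lincomb by metis
  obtain M where M: "M > 0" "\<And>i. norm (e i) \<le> M" using norm_e_bounded by metis
  have le: "\<phi> n \<le> \<Phi> n" for n
    unfolding \<phi>_def lincomb_def by (simp add: norm_sum_e_le)
  have ge: "\<Phi> n \<le> C * \<phi> n" if "n \<ge> 1" for n
  proof -
    have "1 \<in> (\<lambda>_. 1 :: real) ` {..<n}" using that by (intro image_eqI[of _ _ 0]) auto
    from C(2)[OF this] show ?thesis by (simp add: \<phi>_def)
  qed
  have pos: "\<phi> n > 0" if "n \<ge> 1" for n
    using ge[OF that] \<Phi>_pos[OF that] C(1) by (metis less_le_trans zero_less_mult_pos)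
  obtain s where s: "0 \<le> s" "s \<le> 1"
    "\<And>n. n \<ge> 1 \<Longrightarrow> \<phi> n \<le> K * real n powr s" "\<And>n. n \<ge> 1 \<Longrightarrow> real n powr s \<le> K * \<phi> n"
  proof (rule quasi_multiplicative_power_law[of \<phi> C K M])
    show "\<phi> n \<le> C * \<phi> m" if "1 \<le> n" "n \<le> m" for n m
      using le[of n] \<Phi>_mono[OF that(2)] ge[of m] that by linarith
    show "\<phi> (n * m) \<le> K * \<phi> n * \<phi> m" if "1 \<le> n" "1 \<le> m" for n m
      using norm_lincomb_div_mod(2)[of n "\<lambda>_. 1" m "\<lambda>_. 1"] that by (simp add: \<phi>_def)
    show "\<phi> n * \<phi> m \<le> K * \<phi> (n * m)" if "1 \<le> n" "1 \<le> m" for n m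
      using norm_lincomb_div_mod(1)[of n "\<lambda>_. 1" m "\<lambda>_. 1"] that by (simp add: \<phi>_def)
    show "\<phi> n \<le> M * real n" for n
      using le[of n] fundamental_function_leI[OF norm_sum_le_card[of e M, OF M(2)]] by (rule order_trans)
  qed (use pos C K_pos M in auto)
  show ?thesis
  proof (rule that[OF s(1,2)])
    \<comment> \<open>The upper bound needs \<open>K * C\<close> and the lower one \<open>K\<close>;
      their sum serves both.\<close>
    show "K * (1 + C) > 0" using K_pos C by simp
    fix n :: nat assume n: "n \<ge> 1"
    have "\<Phi> n \<le> C * (K * real n powr s)"
      using ge[OF n] s(3)[OF n] C(1) by (meson mult_left_mono order_trans less_imp_le)
    moreover have "K * real n powr s \<ge> 0" using K_pos by simp
    ultimately show "\<Phi> n \<le> K * (1 + C) * real n powr s" by (simp add: algebra_simps)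
    have "real n powr s \<le> K * \<Phi> n"
      using s(4)[OF n] le[of n] K_pos by (meson mult_left_mono order_trans less_imp_le)
    moreover have "K * C * \<Phi> n \<ge> 0" using K_pos C(1) \<Phi>_pos[OF n] by simp
    ultimately show "real n powr s \<le> K * (1 + C) * \<Phi> n" by (simp add: algebra_simps)
  qed
qed

lemma norm_lincomb_equiv_fin_norm:
  obtains s where "0 \<le> s" "s \<le> 1"
    "\<And>a n. n > 0 \<Longrightarrow> a (n - 1) \<noteq> 0 \<Longrightarrow>
      norm (lincomb a n) \<le> K * fin_norm s a n \<and> fin_norm s a n \<le> K * norm (lincomb a n)"
proof -
  obtain C where C: "C > 0"
    "\<And>a n v. v \<in> a ` {..<n} \<Longrightarrow> \<bar>v\<bar> * \<Phi> (card (level a n v)) \<le> C * norm (lincomb a n)"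
    using level_le_norm_lincomb by metis
  obtain s D where s: "0 \<le> s" "s \<le> 1" "D > 0"
    and D: "\<And>n. n \<ge> 1 \<Longrightarrow> \<Phi> n \<le> D * real n powr s" "\<And>n. n \<ge> 1 \<Longrightarrow> real n powr s \<le> D * \<Phi> n"
    using \<Phi>_power_law by metis
  \<comment> \<open>Crude comparison in both directions, off by the number of distinct coordinates;
    it is applied below to tensor powers only.\<close>
  have upper: "norm (lincomb x m) \<le> real (card (x ` {..<m})) * (D * fin_norm s x m)" for x m
  proof -
    have "norm (lincomb x m) \<le> (\<Sum>v\<in>x ` {..<m}. \<bar>v\<bar> * \<Phi> (card (level x m v)))"
      by (rule norm_lincomb_le_level)
    also have "\<dots> \<le> (\<Sum>v\<in>x ` {..<m}. D * fin_norm s x m)"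
    proof (rule sum_mono)
      fix v assume v: "v \<in> x ` {..<m}"
      have "\<bar>v\<bar> * \<Phi> (card (level x m v)) \<le> \<bar>v\<bar> * (D * real (card (level x m v)) powr s)"
        using card_level_pos[OF v] by (intro mult_left_mono D) auto
      also have "\<dots> = D * (\<bar>v\<bar> * real (card (level x m v)) powr s)" by simp
      also have "\<dots> \<le> D * fin_norm s x m"
        using s by (intro mult_left_mono level_le_fin_norm v) auto
      finally show "\<bar>v\<bar> * \<Phi> (card (level x m v)) \<le> D * fin_norm s x m" .
    qed
    finally show ?thesis by simp
  qed
  have lower: "fin_norm s x m \<le> real (card (x ` {..<m})) * (D * C * norm (lincomb x m))" if "m > 0" for x m
  proof (rule fin_norm_le_level[OF that s(1,2)])
    fix v assume v: "v \<in> x ` {..<m}"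
    have "\<bar>v\<bar> * real (card (level x m v)) powr s \<le> \<bar>v\<bar> * (D * \<Phi> (card (level x m v)))"
      using card_level_pos[OF v] by (intro mult_left_mono D) auto
    also have "\<dots> = D * (\<bar>v\<bar> * \<Phi> (card (level x m v)))" by simp
    also have "\<dots> \<le> D * (C * norm (lincomb x m))"
      using s by (intro mult_left_mono C v) auto
    finally show "\<bar>v\<bar> * real (card (level x m v)) powr s \<le> D * C * norm (lincomb x m)" by simp
  qed
  show ?thesis
  proof (rule that[OF s(1,2)])
    fix a :: "nat \<Rightarrow> real" and n :: nat
    assume n: "n > 0" "a (n - 1) \<noteq> 0"
    let ?X = "fin_norm s a n" and ?x = "\<lambda>N. tensor_power a n N"
    note X0 = fin_norm_nonneg[OF n(1), of s a]
    have card: "real (card (?x N ` {..<n ^ N})) \<le> real (Suc N) ^ n" for N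
      using tensor_power_values[OF n(1), of a N] by (metis of_nat_le_iff of_nat_power)
    \<comment> \<open>The factor \<open>K ^ N\<close> comes from the multiplicativity of the norm,
      \<open>?X ^ N\<close> from the exact multiplicativity of \<open>fin_norm\<close>, and
      \<open>(N + 1) ^ n\<close> from counting values.\<close>
    have up: "norm (lincomb a n) ^ N * norm (e 0) \<le> D * real (Suc N) ^ n * (K * ?X) ^ N" for N
    proof -
      have "norm (lincomb a n) ^ N * norm (e 0) \<le> K ^ N * norm (lincomb (?x N) (n ^ N))"
        by (rule norm_lincomb_tensor_power(1)[where a=a, OF n])
      also have "norm (lincomb (?x N) (n ^ N)) \<le> real (card (?x N ` {..<n ^ N})) * (D * ?X ^ N)"
        using upper[of "?x N" "n ^ N"] by (simp add: fin_norm_tensor_power[OF n(1)])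
      also have "\<dots> \<le> real (Suc N) ^ n * (D * ?X ^ N)"
        using s X0 by (intro mult_right_mono card) auto
      finally show ?thesis using K_pos by (simp add: mult_ac power_mult_distrib)
    qed
    have low: "?X ^ N * 1 \<le> (D * C * norm (e 0)) * real (Suc N) ^ n * (K * norm (lincomb a n)) ^ N" for N
    proof -
      have "?X ^ N \<le> real (card (?x N ` {..<n ^ N})) * (D * C * norm (lincomb (?x N) (n ^ N)))"
        using lower[of "n ^ N" "?x N"] n by (simp add: fin_norm_tensor_power[OF n(1)])
      also have "\<dots> \<le> real (Suc N) ^ n * (D * C * (K ^ N * norm (lincomb a n) ^ N * norm (e 0)))"
        using s C by (intro mult_mono card mult_left_mono norm_lincomb_tensor_power(2)[where a=a, OF n]) auto
      finally show ?thesis by (simp add: mult_ac power_mult_distrib)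
    qed
    \<comment> \<open>\<open>C\<close>, \<open>D\<close> and \<open>norm (e 0)\<close> enter only
      through the constants independent of \<open>N\<close>, so they disappear and \<open>K\<close>
      remains.\<close>
    have "norm (lincomb a n) \<le> K * ?X"
      by (rule le_if_powers_le_polynomially[OF n(1) _ _ _ up]) (use e_nonzero K_pos X0 in auto)
    moreover have "?X \<le> K * norm (lincomb a n)"
      by (rule le_if_powers_le_polynomially[OF n(1) _ _ _ low]) (use K_pos X0 in auto)
    ultimately show "norm (lincomb a n) \<le> K * ?X \<and> ?X \<le> K * norm (lincomb a n)" by blast
  qed
qed

end

section \<open>Passage to the norms of \<open>c0\<close> and \<open>lp\<close>\<close>

lemma finite_support_last:
  fixes a :: "nat \<Rightarrow> real"
  assumes "finite {i. a i \<noteq> 0}" "a \<noteq> (\<lambda>_. 0)"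
  obtains n where "n > 0" "a (n - 1) \<noteq> 0" "\<And>i. i \<ge> n \<Longrightarrow> a i = 0"
proof -
  have "{i. a i \<noteq> 0} \<noteq> {}" using assms(2) by auto
  then have "a (Max {i. a i \<noteq> 0}) \<noteq> 0" using Max_in[OF assms(1)] by blast
  moreover have "a i = 0" if "i \<ge> Suc (Max {i. a i \<noteq> 0})" for i
    using that Max_ge[OF assms(1), of i] by fastforce
  ultimately show ?thesis using that[of "Suc (Max {i. a i \<noteq> 0})"] by auto
qed

lemma sum_unit_vec:
  assumes "finite {i. a i \<noteq> 0}"
  shows "(\<lambda>k. \<Sum>i | a i \<noteq> 0. a i * unit_vec i k) = a"
proof
  fix k
  have "(\<Sum>i | a i \<noteq> 0. a i * unit_vec i k) = (\<Sum>i | a i \<noteq> 0. if k = i then a i else 0)"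
    by (intro sum.cong) (auto simp: unit_vec_def)
  also have "\<dots> = a k" using assms by (simp add: sum.delta)
  finally show "(\<Sum>i | a i \<noteq> 0. a i * unit_vec i k) = a k" .
qed

lemma c0_norm_eq_fin_norm:
  assumes "n > 0" "\<And>i. i \<ge> n \<Longrightarrow> a i = 0"
  shows "c0_norm a = fin_norm 0 a n"
proof -
  have le: "\<bar>a i\<bar> \<le> Max ((\<lambda>i. \<bar>a i\<bar>) ` {..<n})" for i
  proof (cases "i < n")
    case False
    then show ?thesis using assms fin_norm_nonneg[of n 0 a] by (simp add: fin_norm_def)
  qed (auto intro!: Max_ge)
  have "Max ((\<lambda>i. \<bar>a i\<bar>) ` {..<n}) \<in> (\<lambda>i. \<bar>a i\<bar>) ` {..<n}"
    using assms by (intro Max_in) auto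
  then have "c0_norm a = Max ((\<lambda>i. \<bar>a i\<bar>) ` {..<n})"
    unfolding c0_norm_def using le by (intro cSup_eq_maximum) auto
  then show ?thesis by (simp add: fin_norm_def)
qed

lemma lp_norm_eq_fin_norm:
  assumes "s \<noteq> 0" "\<And>i. i \<ge> n \<Longrightarrow> a i = 0"
  shows "lp_norm (1 / s) a = fin_norm s a n"
proof -
  have "(\<Sum>k. \<bar>a k\<bar> powr (1 / s)) = (\<Sum>k<n. \<bar>a k\<bar> powr (1 / s))"
    using assms by (intro suminf_finite) auto
  then show ?thesis using assms by (simp add: lp_norm_def fin_norm_def)
qed

context tensor_basis
begin

lemma equivalent_toI:
  assumes N0: "N (\<lambda>_. 0) = 0"
    and N: "\<And>a n. n > 0 \<Longrightarrow> (\<And>i. i \<ge> n \<Longrightarrow> a i = 0) \<Longrightarrow> N a = fin_norm s a n"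
    and fin: "\<And>a n. n > 0 \<Longrightarrow> a (n - 1) \<noteq> 0 \<Longrightarrow>
      norm (lincomb a n) \<le> K * fin_norm s a n \<and> fin_norm s a n \<le> K * norm (lincomb a n)"
  shows "equivalent_to e N unit_vec"
  unfolding equivalent_to_def
proof (intro exI[of _ K] conjI allI impI K_pos)
  fix a :: "nat \<Rightarrow> real"
  assume a: "finite {i. a i \<noteq> 0}"
  have "norm (\<Sum>i | a i \<noteq> 0. a i *\<^sub>R e i) \<le> K * N a \<and> N a \<le> K * norm (\<Sum>i | a i \<noteq> 0. a i *\<^sub>R e i)"
  \<comment> \<open>The zero sequence has no last nonzero coefficient and is covered by
    \<open>N0\<close>; otherwise the sum is cut at that coefficient, where \<open>fin\<close>
    applies.\<close>
  proof (cases "a = (\<lambda>_. 0)")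
    case False
    then obtain n where n: "n > 0" "a (n - 1) \<noteq> 0" "\<And>i. i \<ge> n \<Longrightarrow> a i = 0"
      using finite_support_last[OF a] by metis
    have "(\<Sum>i | a i \<noteq> 0. a i *\<^sub>R e i) = lincomb a n"
      unfolding lincomb_def using n(3) by (intro sum.mono_neutral_left) (auto simp: not_le[symmetric])
    then show ?thesis using fin[where a=a, OF n(1,2)] N[where a=a, OF n(1,3)] by simp
  qed (simp add: N0)
  then show "1 / K * norm (\<Sum>i | a i \<noteq> 0. a i *\<^sub>R e i) \<le> N (\<lambda>k. \<Sum>i | a i \<noteq> 0. a i * unit_vec i k)"
    and "N (\<lambda>k. \<Sum>i | a i \<noteq> 0. a i * unit_vec i k) \<le> K * norm (\<Sum>i | a i \<noteq> 0. a i *\<^sub>R e i)"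
    unfolding sum_unit_vec[OF a] using K_pos by (auto simp: field_simps)
qed

lemma equivalent_to_c0_or_lp:
  "equivalent_to e c0_norm unit_vec \<or> (\<exists>p\<ge>1. equivalent_to e (lp_norm p) unit_vec)"
proof -
  obtain s where s: "0 \<le> s" "s \<le> 1"
    and fin: "\<And>a n. n > 0 \<Longrightarrow> a (n - 1) \<noteq> 0 \<Longrightarrow>
      norm (lincomb a n) \<le> K * fin_norm s a n \<and> fin_norm s a n \<le> K * norm (lincomb a n)"
    using norm_lincomb_equiv_fin_norm by metis
  show ?thesis
  proof (cases "s = 0")
    case True
    have "equivalent_to e c0_norm unit_vec"
      by (rule equivalent_toI[where s=s])
        (use fin c0_norm_eq_fin_norm True in \<open>auto simp: c0_norm_def\<close>)
    then show ?thesis ..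
  next
    case False
    have "equivalent_to e (lp_norm (1 / s)) unit_vec"
      by (rule equivalent_toI[where s=s])
        (use fin lp_norm_eq_fin_norm[OF False] in \<open>auto simp: lp_norm_def\<close>)
    moreover have "1 / s \<ge> 1" using s False by simp
    ultimately show ?thesis by blast
  qed
qed

end

theorem theorem5:
  fixes e :: "nat \<Rightarrow> 'a::banach"
  assumes "schauder_basis e"
    and "semi_normalized e"
    and "bidemocratic e"
    and "\<exists>K>0. \<forall>\<alpha>\<in>span (range e). \<forall>\<beta>\<in>span (range e).
           1 / K * norm \<alpha> * norm \<beta> \<le> norm (seq_mult e \<alpha> \<beta>) \<and>
           norm (seq_mult e \<alpha> \<beta>) \<le> K * norm \<alpha> * norm \<beta>"
  shows "equivalent_to e c0_norm unit_vec \<or>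
         (\<exists>p\<ge>1. equivalent_to e (lp_norm p) unit_vec)"
proof -
  obtain K where K: "K > 0"
    "\<And>\<alpha> \<beta>. \<alpha> \<in> span (range e) \<Longrightarrow> \<beta> \<in> span (range e) \<Longrightarrow>
      1 / K * norm \<alpha> * norm \<beta> \<le> norm (seq_mult e \<alpha> \<beta>) \<and>
      norm (seq_mult e \<alpha> \<beta>) \<le> K * norm \<alpha> * norm \<beta>"
    using assms(4) by blast
  interpret tensor_basis e K
  proof
    fix \<alpha> \<beta> assume "\<alpha> \<in> span (range e)" "\<beta> \<in> span (range e)"
    from K(2)[OF this] show "norm \<alpha> * norm \<beta> \<le> K * norm (seq_mult e \<alpha> \<beta>)"
      and "norm (seq_mult e \<alpha> \<beta>) \<le> K * norm \<alpha> * norm \<beta>"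
      using K(1) by (simp_all add: field_simps)
  qed (use assms K(1) in auto)
  show ?thesis by (rule equivalent_to_c0_or_lp)
qed

end
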